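(* $\sup_{n\in\mathbb{N}}|\delta_5(n)|=+\infty$. More precisely, let \[u_n=\sum_{p=0}^{n-1}A_{5,6p},\qquad u'_n=\sum_{p=0}^{n-1}A_{5,6p+3}.\] There exist real constants $C,C_2,C'_2,K,K_2,K'_2>0$ such that for all $n\ge0$, \[\delta_5(u_n)>Cn-C_2\qquad\text{and}\qquad \delta_5(u'_n)<-Cn+C'_2,\] and for all $n\ge1$, \[\delta_5(u_n)>K\ln(u_n)-K_2\qquad\text{and}\qquad \delta_5(u'_n)<-K\ln(u'_n)+K'_2.\]
   Context: $F_5:\mathbb{N}\to\mathbb{N}$ is defined by $F_5(0)=0$ and $F_5(n)=n-F_5^5(n-1)$ for $n\ge1$, where $F_5^5$ is the 5-fold iterate of $F_5$. The sequence $(A_{5,p})_{p\ge0}$ is defined by $A_{5,p}=p+1$ for $0\le p<5$ and $A_{5,p}=A_{5,p-1}+A_{5,p-5}$ for $p\ge5$. $\alpha_5$ is the unique positive real zero of $X^5+X-1$, and $\delta_5(n)=F_5(n)-\alpha_5 n$. *)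

theory Defs
  imports Complex_Main "HOL-Library.Extended_Real"
begin

text \<open>
  The nested recursion F(n) = n - F(F(F(F(F(n-1))))).  Termination of the nested calls rests
  on the bound F(n) \<le> n, which also shows that the truncated subtraction never truncates.
\<close>

function F5 :: "nat \<Rightarrow> nat" where
  "F5 0 = 0"
| "F5 (Suc n) = Suc n - F5 (F5 (F5 (F5 (F5 n))))"
  by pat_completeness auto

lemma F5_dom_le: "F5_dom n \<Longrightarrow> F5 n \<le> n"
  by (induction n rule: F5.pinduct) (simp_all add: F5.psimps)

termination F5
proof (relation "measure id")
  fix n
  assume d1: "F5_dom n"
  show "(F5 n, Suc n) \<in> measure id"
    using F5_dom_le[OF d1] by simp
  assume d2: "F5_dom (F5 n)"
  show "(F5 (F5 n), Suc n) \<in> measure id"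
    using F5_dom_le[OF d1] F5_dom_le[OF d2] by simp
  assume d3: "F5_dom (F5 (F5 n))"
  show "(F5 (F5 (F5 n)), Suc n) \<in> measure id"
    using F5_dom_le[OF d1] F5_dom_le[OF d2] F5_dom_le[OF d3] by simp
  assume d4: "F5_dom (F5 (F5 (F5 n)))"
  show "(F5 (F5 (F5 (F5 n))), Suc n) \<in> measure id"
    using F5_dom_le[OF d1] F5_dom_le[OF d2] F5_dom_le[OF d3] F5_dom_le[OF d4] by simp
qed simp_all

lemma F5_le: "F5 n \<le> n"
  by (induction n rule: F5.induct) simp_all

lemma F5_iterate_le: "(F5 ^^ k) n \<le> n"
  by (induction k) (auto intro: order_trans[OF F5_le])

lemma F5_rec:
  assumes "n \<ge> 1"
  shows "int (F5 n) = int n - int ((F5 ^^ 5) (n - 1))"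
proof -
  obtain m where m: "n = Suc m"
    using assms by (cases n) auto
  have "F5 (Suc m) = Suc m - (F5 ^^ 5) m"
    by (simp add: eval_nat_numeral)
  moreover have "(F5 ^^ 5) m \<le> Suc m"
    using F5_iterate_le[of 5 m] by simp
  ultimately show ?thesis
    unfolding m by (simp only: diff_Suc_1 of_nat_diff)
qed

fun A5 :: "nat \<Rightarrow> nat" where
  "A5 p = (if p < 5 then p + 1 else A5 (p - 1) + A5 (p - 5))"

declare A5.simps [simp del]

definition alpha5 :: real where
  "alpha5 = (THE x. x > 0 \<and> x ^ 5 + x - 1 = 0)"

lemma alpha5_ex1: "\<exists>!x::real. x > 0 \<and> x ^ 5 + x - 1 = 0"
proof -
  have "\<exists>x::real\<ge>0. x \<le> 1 \<and> x ^ 5 + x - 1 = 0"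
    by (rule IVT') (auto intro!: continuous_intros)
  then obtain x :: real where x: "x \<ge> 0" "x ^ 5 + x - 1 = 0"
    by blast
  have "x \<noteq> 0"
    using x(2) by auto
  with x have pos: "x > 0"
    by simp
  show ?thesis
  proof (rule ex1I[of _ x])
    show "x > 0 \<and> x ^ 5 + x - 1 = 0"
      using pos x by simp
    fix y :: real
    assume y: "y > 0 \<and> y ^ 5 + y - 1 = 0"
    have "x < y \<Longrightarrow> x ^ 5 < y ^ 5" "y < x \<Longrightarrow> y ^ 5 < x ^ 5"
      using x(1) y by (auto intro: power_strict_mono)
    then show "y = x"
      using x(2) y by linarith
  qed
qed

definition delta5 :: "nat \<Rightarrow> real" where
  "delta5 n = real (F5 n) - alpha5 * real n"

definition u5 :: "nat \<Rightarrow> nat" where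
  "u5 n = (\<Sum>p<n. A5 (6 * p))"

definition u5' :: "nat \<Rightarrow> nat" where
  "u5' n = (\<Sum>p<n. A5 (6 * p + 3))"

end

theory Submission imports Defs begin

text \<open>
  Adding a large term of the sequence \<open>A5\<close> to a small number is compatible with \<open>F5\<close>, which just
  decrements the index of that term.  Hence \<open>delta5\<close> of a sum of sufficiently spaced terms
  \<open>A5 p\<close> is the sum of the defects \<open>A5 (p - 1) - alpha5 * A5 p\<close>.  These defects satisfy the
  recurrence with characteristic polynomial \<open>X^5 - X^4 - 1 = (X^2 - X + 1) * (X^3 - X - 1)\<close>.  The
  roots of the first factor are primitive sixth roots of unity, so the corresponding part of the
  defect has period \<open>6\<close> and is negated by a shift of \<open>3\<close>: along a progression of step \<open>6\<close> it is a
  constant and its sum grows linearly.  The remaining part has no component along the plastic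
  number \<open>1 / alpha5\<close>; it is bounded, and its sums along the progression telescope to bounded
  quantities.
\<close>

section \<open>The sequence \<open>A5\<close>\<close>

text \<open>Thanks to truncated subtraction this recurrence covers the initial values as well.\<close>

lemma A5_Suc: "A5 (Suc p) = A5 p + A5 (p - 4)"
proof (cases "p < 4")
  case True
  then show ?thesis
    by (simp add: A5.simps)
next
  case False
  then have "A5 (Suc p) = A5 (Suc p - 1) + A5 (Suc p - 5)"
    by (subst A5.simps) simp
  then show ?thesis
    by simp
qed

lemma A5_0: "A5 0 = 1"
  by (simp add: A5.simps)

lemma A5_mono: "p \<le> q \<Longrightarrow> A5 p \<le> A5 q"
  by (induction rule: dec_induct) (simp_all add: A5_Suc)

lemma A5_pos: "A5 p > 0"
  using A5_mono[of 0 p] by (simp add: A5_0)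

lemma A5_le_power2: "A5 p \<le> 2 ^ p"
proof (induction p)
  case 0
  then show ?case
    by (simp add: A5_0)
next
  case (Suc p)
  then show ?case
    using A5_mono[of "p - 4" p] by (simp add: A5_Suc)
qed

lemma A5_small:
  "A5 1 = 2" "A5 (Suc 0) = 2" "A5 2 = 3" "A5 3 = 4" "A5 4 = 5" "A5 5 = 6"
  using A5_Suc[of 4] by (simp_all add: A5.simps)

section \<open>\<open>F5\<close> shifts the indices of spaced sums of \<open>A5\<close>\<close>

declare F5.simps(2) [simp del]

lemma F5_Suc_add: "F5 (Suc n) + (F5 ^^ 5) n = Suc n"
  using F5_rec[of "Suc n"] by simp

text \<open>Subtracting consecutive instances of the recursion, an increment of \<open>F5\<close> is
  one minus an earlier increment of its fifth iterate; increments in {0, 1} survive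
  composition.\<close>

lemma F5_Suc_bounds: "F5 n \<le> F5 (Suc n) \<and> F5 (Suc n) \<le> Suc (F5 n)"
proof (induction n rule: less_induct)
  case (less n)
  show ?case
  proof (cases n)
    case 0
    then show ?thesis
      by (simp add: F5.simps(2))
  next
    case (Suc m)
    have "(F5 ^^ j) m \<le> (F5 ^^ j) n \<and> (F5 ^^ j) n \<le> Suc ((F5 ^^ j) m)" for j
    proof (induction j)
      case 0
      then show ?case
        by (simp add: Suc)
    next
      case (Suc j)
      let ?k = "(F5 ^^ j) m"
      have "?k < n"
        using F5_iterate_le[of j m] \<open>n = Suc m\<close> by simp
      then have "F5 ?k \<le> F5 (Suc ?k) \<and> F5 (Suc ?k) \<le> Suc (F5 ?k)"
        by (rule less)
      moreover have "(F5 ^^ j) n = ?k \<or> (F5 ^^ j) n = Suc ?k"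
        using Suc by linarith
      ultimately show ?case
        by auto
    qed
    from this[of 5] show ?thesis
      using F5_Suc_add[of n] F5_Suc_add[of m, folded Suc] Suc by linarith
  qed
qed

lemma F5_mono: "m \<le> n \<Longrightarrow> F5 m \<le> F5 n"
  by (induction rule: dec_induct) (use F5_Suc_bounds order_trans in blast)+

lemma F5_small:
  "F5 (Suc 0) = 1" "F5 1 = 1" "F5 2 = 1" "F5 3 = 2" "F5 4 = 3" "F5 5 = 4" "F5 6 = 5" "F5 7 = 6" "F5 8 = 6"
proof -
  show 1: "F5 (Suc 0) = 1" "F5 1 = 1"
    using F5.simps(2)[of 0] by simp_all
  show 2: "F5 2 = 1"
    using F5.simps(2)[of 1] 1 by (simp flip: numeral_2_eq_2)
  show 3: "F5 3 = 2"
    using F5.simps(2)[of 2] 1 2 by simp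
  show 4: "F5 4 = 3"
    using F5.simps(2)[of 3] 1 2 3 by simp
  show 5: "F5 5 = 4"
    using F5.simps(2)[of 4] 1 2 3 4 by simp
  show 6: "F5 6 = 5"
    using F5.simps(2)[of 5] 1 2 3 4 5 by simp
  show 7: "F5 7 = 6"
    using F5.simps(2)[of 6] 1 2 3 4 5 6 by simp
  show "F5 8 = 6"
    using F5.simps(2)[of 7] 1 2 3 4 5 6 7 by simp
qed

text \<open>The bound on \<open>m\<close> reproduces itself: \<open>F5\<close> is monotone and
  lowers the index on both sides of it, so the shift can be applied five times and fed into the
  recursion.\<close>

lemma F5_A5_add:
  assumes "p \<ge> 1" "m \<le> A5 (p - 4)"
  shows "F5 (A5 p + m) = A5 (p - 1) + F5 m"
  using assms
proof (induction "A5 p + m" arbitrary: p m rule: less_induct)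
  case less
  show ?case
  proof (cases "p \<le> 5")
    case True
    then consider "p = 1" | "p = 2" | "p = 3" | "p = 4" | "p = 5"
      using less.prems(1) by linarith
    \<comment> \<open>Truncation makes the bound \<open>A5 0 = 1\<close> for
      \<open>p \<le> 4\<close>; it is \<open>A5 1 = 2\<close> for \<open>p = 5\<close>.\<close>
    moreover have "m = 0 \<or> m = 1 \<or> (p = 5 \<and> m = 2)"
    proof (cases "p = 5")
      case True
      then show ?thesis
        using less.prems(2) by (auto simp: A5_small)
    next
      case False
      then show ?thesis
        using less.prems(2) \<open>p \<le> 5\<close> by (auto simp: A5_0)
    qed
    ultimately show ?thesis
      by cases (auto simp: A5_small A5_0 F5_small simp flip: numeral_2_eq_2)
  next
    case False
    have A5_p: "A5 p = A5 (p - 1) + A5 (p - 5)"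
      using A5_Suc[of "p - 1"] False by simp
    have F5_A5: "F5 (A5 q) = A5 (q - 1)" if "A5 q < A5 p + m" for q
      using less.hyps[of q 0] that F5_small(1) by (cases q) (auto simp: A5_0)
    have iter: "(F5 ^^ 5) (A5 q + k) = A5 (q - 5) + (F5 ^^ 5) k"
      if q: "q \<ge> 5" "q \<le> p" and k: "k \<le> A5 (q - 4)" "A5 q + k < A5 p + m" for q k
    proof -
      have "j \<le> 5 \<Longrightarrow> (F5 ^^ j) (A5 q + k) = A5 (q - j) + (F5 ^^ j) k \<and>
              (F5 ^^ j) k \<le> A5 (q - 4 - j)" for j
      proof (induction j)
        case 0
        then show ?case
          using k by simp
      next
        case (Suc j)
        let ?k = "(F5 ^^ j) k"
        have IH: "(F5 ^^ j) (A5 q + k) = A5 (q - j) + ?k" "?k \<le> A5 (q - 4 - j)"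
          using Suc by simp_all
        have "A5 (q - j) + ?k < A5 p + m"
          using A5_mono[of "q - j" q] F5_iterate_le[of j k] k(2) by linarith
        then have "F5 (A5 (q - j) + ?k) = A5 (q - j - 1) + F5 ?k"
          using less.hyps[of "q - j" ?k] IH(2) Suc.prems q by (simp add: diff_diff_add add.commute)
        moreover have "F5 ?k \<le> A5 (q - 4 - j - 1)"
        proof -
          have "A5 (q - 4 - j) < A5 p + m"
          proof -
            have "A5 (q - 4 - j) \<le> A5 (p - 1)"
              using q by (intro A5_mono) simp
            also have "\<dots> < A5 p"
              using A5_p A5_pos[of "p - 5"] by simp
            finally show ?thesis
              by simp
          qed
          then show ?thesis
            using F5_mono[OF IH(2)] F5_A5 by simp
        qed
        ultimately show ?case
          using IH(1) by simp
      qed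
      from this[of 5] show ?thesis
        by simp
    qed
    show ?thesis
    proof (cases m)
      case (Suc k)
      then have "(F5 ^^ 5) (A5 p + k) = A5 (p - 5) + (F5 ^^ 5) k"
        using iter[of p k] less.prems False by simp
      then show ?thesis
        using F5_Suc_add[of "A5 p + k"] F5_Suc_add[of k] A5_p Suc by simp
    next
      case 0
      \<comment> \<open>The predecessor of \<open>A5 p\<close> is \<open>A5 (p - 1) + k\<close>, and
        \<open>k < A5 (p - 5)\<close> is within the bound for index \<open>p - 1\<close>.\<close>
      obtain k where k: "A5 (p - 5) = Suc k"
        using A5_pos[of "p - 5"] gr0_conv_Suc by auto
      have "(F5 ^^ 5) (A5 (p - 1) + k) = A5 (p - 6) + (F5 ^^ 5) k"
        using iter[of "p - 1" k] k A5_p False by simp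
      moreover have "F5 (Suc k) = A5 (p - 6)"
        using F5_A5[of "p - 5"] A5_p A5_pos[of "p - 1"] k by simp
      ultimately show ?thesis
        using F5_Suc_add[of "A5 (p - 1) + k"] F5_Suc_add[of k] A5_p k 0
        by simp
    qed
  qed
qed

section \<open>Sums of every sixth term of \<open>A5\<close>\<close>

definition A5_sum :: "nat \<Rightarrow> nat \<Rightarrow> nat" where
  "A5_sum r n = (\<Sum>p<n. A5 (6 * p + r))"

lemma A5_sum_Suc: "A5_sum r (Suc n) = A5 (6 * n + r) + A5_sum r n"
  by (simp add: A5_sum_def)

text \<open>Supplies the smallness hypothesis of \<open>F5_A5_add\<close>. Each step needs the index
  to grow by only 5, so a spacing of 6 suffices.\<close>

lemma A5_sum_le: "A5_sum r n \<le> A5 (6 * n + r - 4)"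
proof (induction n)
  case 0
  then show ?case
    by (simp add: A5_sum_def)
next
  case (Suc n)
  have "A5_sum r (Suc n) \<le> A5 (Suc (6 * n + r))"
    using Suc by (simp add: A5_sum_Suc A5_Suc)
  also have "\<dots> \<le> A5 (6 * Suc n + r - 4)"
    by (intro A5_mono) simp
  finally show ?case .
qed

lemma F5_A5_sum: "F5 (A5_sum r n) = (\<Sum>p<n. A5 (6 * p + r - 1))"
proof (induction n)
  case 0
  then show ?case
    by (simp add: A5_sum_def)
next
  case (Suc n)
  have "F5 (A5_sum r (Suc n)) = A5 (6 * n + r - 1) + F5 (A5_sum r n)"
  proof (cases "6 * n + r = 0")
    \<comment> \<open>Index 0 lies outside \<open>F5_A5_add\<close>, but truncation gives
      \<open>0 - 1 = 0\<close>, in agreement with \<open>F5 1 = 1 = A5 0\<close>.\<close>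
    case True
    then show ?thesis
      by (simp add: A5_sum_def A5_0 F5_small)
  next
    case False
    then have "6 * n + r \<ge> 1"
      by linarith
    then show ?thesis
      using F5_A5_add[of "6 * n + r" "A5_sum r n"] A5_sum_le[of r n] by (simp add: A5_sum_Suc)
  qed
  then show ?case
    using Suc by simp
qed

lemma A5_sum_le_power: "A5_sum r n \<le> 2 ^ r * 64 ^ n"
proof (induction n)
  case 0
  then show ?case
    by (simp add: A5_sum_def)
next
  case (Suc n)
  have "(2::nat) ^ (6 * n + r) = 2 ^ r * 64 ^ n"
    by (simp add: power_add power_mult)
  then have "A5 (6 * n + r) \<le> 2 ^ r * 64 ^ n"
    using A5_le_power2[of "6 * n + r"] by simp
  then show ?case
    using Suc by (simp add: A5_sum_Suc)
qed

lemma A5_sum_pos: "n \<ge> 1 \<Longrightarrow> A5_sum r n > 0"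
  by (cases n) (simp_all add: A5_sum_Suc A5_pos)

lemma u5_eq: "u5 n = A5_sum 0 n" and u5'_eq: "u5' n = A5_sum 3 n"
  by (simp_all add: u5_def u5'_def A5_sum_def)

section \<open>The constant \<open>alpha5\<close>\<close>

lemma alpha5_root: "alpha5 > 0" "alpha5 ^ 5 + alpha5 = 1"
  using theI'[OF alpha5_ex1, folded alpha5_def] by simp_all

text \<open>This threshold is exactly what makes the drift \<open>osc 0\<close> positive.\<close>

lemma alpha5_gt: "alpha5 > 2 / 3"
proof (rule ccontr)
  assume "\<not> alpha5 > 2 / 3"
  then have "alpha5 ^ 5 \<le> (2 / 3) ^ 5"
    using alpha5_root(1) by (intro power_mono) simp_all
  then show False
    using \<open>\<not> alpha5 > 2 / 3\<close> alpha5_root(2) by (simp add: power_divide)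
qed

lemma alpha5_less: "alpha5 < 4 / 5"
proof (rule ccontr)
  assume "\<not> alpha5 < 4 / 5"
  then have "alpha5 ^ 5 \<ge> (4 / 5) ^ 5"
    by (intro power_mono) simp_all
  then show False
    using \<open>\<not> alpha5 < 4 / 5\<close> alpha5_root(2) by (simp add: power_divide)
qed

lemma alpha5_cubic: "alpha5 ^ 3 + alpha5 ^ 2 = 1"
proof -
  have "(alpha5 ^ 2 - alpha5 + 1) * (alpha5 ^ 3 + alpha5 ^ 2 - 1) = alpha5 ^ 5 + alpha5 - 1"
    by algebra
  moreover have "alpha5 ^ 2 - alpha5 + 1 > 0"
    using alpha5_less zero_le_power2[of alpha5] by linarith
  ultimately show ?thesis
    using alpha5_root(2) by simp
qed

section \<open>Splitting the defect\<close>

definition defect :: "nat \<Rightarrow> real" where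
  "defect p = real (A5 (p - 1)) - alpha5 * real (A5 p)"

lemma delta5_A5_sum: "delta5 (A5_sum r n) = (\<Sum>p<n. defect (6 * p + r))"
  unfolding delta5_def F5_A5_sum
  by (simp add: A5_sum_def defect_def sum_subtractf sum_distrib_left)

lemma defect_rec: "defect (p + 5) = defect (p + 4) + defect p"
proof -
  have "A5 (p + 5) = A5 (p + 4) + A5 p"
    using A5_Suc[of "p + 4"] by (simp add: eval_nat_numeral)
  \<comment> \<open>Also valid at \<open>p = 0\<close>, where \<open>p - 1\<close> is truncated:
    \<open>5 = 4 + 1\<close>.\<close>
  moreover have "A5 (p + 4) = A5 (p + 3) + A5 (p - 1)"
    using A5_Suc[of "p + 3"] by (simp add: eval_nat_numeral)
  ultimately show ?thesis
    by (simp add: defect_def algebra_simps)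
qed

lemma defect_small:
  "defect 0 = 1 - alpha5" "defect 1 = 1 - 2 * alpha5" "defect 2 = 2 - 3 * alpha5"
  "defect 3 = 3 - 4 * alpha5" "defect 4 = 4 - 5 * alpha5"
  by (simp_all add: defect_def A5_0 A5_small)

text \<open>
  The operator \<open>(X - 3) * (X^3 - X - 1) / 7\<close>, with \<open>X\<close> the shift of sequences, is the projection
  onto the kernel of \<open>X^2 - X + 1\<close>, by Bezout's identity for the two factors.
\<close>

definition osc :: "nat \<Rightarrow> real" where
  "osc p = (defect (p + 4) - 3 * defect (p + 3) - defect (p + 2) + 2 * defect (p + 1)
            + 3 * defect p) / 7"

definition rest :: "nat \<Rightarrow> real" where
  "rest p = defect p - osc p"

lemma osc_rec: "osc (p + 2) = osc (p + 1) - osc p"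
  using defect_rec[of p] defect_rec[of "p + 1"]
  by (simp add: osc_def eval_nat_numeral field_simps)

text \<open>\<open>X^2 - X + 1\<close> divides \<open>X^3 + 1\<close>.\<close>

lemma osc_add_3: "osc (p + 3) = - osc p"
  using osc_rec[of p] osc_rec[of "p + 1"] by (simp add: eval_nat_numeral)

lemma osc_mult_6_add: "osc (6 * n + r) = osc r"
proof (induction n)
  case (Suc n)
  have "osc (6 * Suc n + r) = osc (6 * n + r + 3 + 3)"
    by (simp add: add_ac)
  then show ?case
    unfolding osc_add_3 using Suc by simp
qed simp

lemma osc_0: "osc 0 = (3 * alpha5 - 2) / 7"
  using defect_small by (simp add: osc_def eval_nat_numeral)

lemma osc_3: "osc 3 = - osc 0"
  using osc_add_3[of 0] by simp

lemma rest_rec: "rest (p + 3) = rest (p + 1) + rest p"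
  using defect_rec[of p] defect_rec[of "p + 1"] defect_rec[of "p + 2"]
  by (simp add: rest_def osc_def eval_nat_numeral field_simps)

text \<open>
  Absence of a component along \<open>1 / alpha5\<close>, since
  \<open>X^3 - X - 1 = (X - 1 / alpha5) * (X^2 + X / alpha5 + alpha5)\<close>.
\<close>

lemma rest_rec2: "alpha5 * rest (p + 2) + rest (p + 1) + alpha5 ^ 2 * rest p = 0"
proof (induction p)
  case 0
  have "7 * rest 0 = 9 - 10 * alpha5" "7 * rest 1 = 10 - 15 * alpha5"
    "7 * rest 2 = 15 - 19 * alpha5"
    using defect_small defect_rec[of 0] defect_rec[of 1]
    by (simp_all add: rest_def osc_def eval_nat_numeral field_simps)
  then have "7 * (alpha5 * rest 2 + rest 1 + alpha5 ^ 2 * rest 0)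
      = 10 * (1 - alpha5 ^ 3 - alpha5 ^ 2)"
    by algebra
  then show ?case
    using alpha5_cubic by (simp add: numeral_2_eq_2)
next
  case (Suc p)
  have "alpha5 * (alpha5 * (rest (p + 1) + rest p) + rest (p + 2) + alpha5 ^ 2 * rest (p + 1))
      = alpha5 * rest (p + 2) + (alpha5 ^ 3 + alpha5 ^ 2) * rest (p + 1) + alpha5 ^ 2 * rest p"
    by algebra
  also have "\<dots> = 0"
    using Suc alpha5_cubic by simp
  finally have "alpha5 * rest (p + 3) + rest (p + 2) + alpha5 ^ 2 * rest (p + 1) = 0"
    using alpha5_root(1) rest_rec[of p] by simp
  then show ?case
    by (simp add: eval_nat_numeral)
qed

text \<open>The quadratic form is positive definite because \<open>4 * alpha5 ^ 3 > 1\<close>.\<close>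

lemma rest_bounded: "\<exists>B. \<forall>p. \<bar>rest p\<bar> \<le> B"
proof -
  \<comment> \<open>This is \<open>alpha5\<close> times the squared modulus of
    \<open>rest (p + 1) - z * rest p\<close>, with \<open>z\<close> a root of
    \<open>X^2 + X / alpha5 + alpha5\<close>. The two conjugate roots have product
    \<open>alpha5\<close>, the factor gained per shift.\<close>
  define q where "q p = alpha5 * rest (p + 1) ^ 2 + rest (p + 1) * rest p + alpha5 ^ 2 * rest p ^ 2"
    for p
  have q_Suc: "q (Suc p) = alpha5 * q p" for p
  proof -
    have "alpha5 * rest (p + 2) = - rest (p + 1) - alpha5 ^ 2 * rest p"
      using rest_rec2[of p] by linarith
    then have "alpha5 * (alpha5 * rest (p + 2) ^ 2 + rest (p + 2) * rest (p + 1)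
          + alpha5 ^ 2 * rest (p + 1) ^ 2)
        = alpha5 * (alpha5 * q p)"
      unfolding q_def by algebra
    then show ?thesis
      using alpha5_root(1) by (simp add: q_def)
  qed
  define d where "d = 4 * alpha5 ^ 3 - 1"
  \<comment> \<open>By \<open>alpha5_cubic\<close> this yields
    \<open>alpha5 ^ 3 \<ge> 9 / 25\<close>.\<close>
  have "alpha5 ^ 2 \<le> (4 / 5) ^ 2"
    using alpha5_root(1) alpha5_less by (intro power_mono) simp_all
  then have d: "d > 0"
    using alpha5_cubic by (simp add: d_def power_divide)
  have lower: "d * rest p ^ 2 \<le> 4 * alpha5 * q p" for p
  proof -
    have "4 * alpha5 * q p = (2 * alpha5 * rest (p + 1) + rest p) ^ 2 + d * rest p ^ 2"
      unfolding q_def d_def by algebra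
    then show ?thesis
      by simp
  qed
  have "q p \<le> q 0" for p
  proof (induction p)
    case (Suc p)
    have "0 \<le> d * rest p ^ 2"
      using d by simp
    then have "0 \<le> 4 * alpha5 * q p"
      using lower[of p] by linarith
    then have "0 \<le> q p"
      using alpha5_root(1) by (simp add: zero_le_mult_iff)
    then have "alpha5 * q p \<le> 1 * q p"
      using alpha5_less by (intro mult_right_mono) simp_all
    then show ?case
      using Suc q_Suc[of p] by simp
  qed simp
  then have "4 * alpha5 * q p \<le> 4 * alpha5 * q 0" for p
    using alpha5_root(1) by (intro mult_left_mono) simp_all
  then have "d * rest p ^ 2 \<le> 4 * alpha5 * q 0" for p
    using lower order_trans by blast
  then have "rest p ^ 2 \<le> 4 * alpha5 * q 0 / d" for p
    using d by (simp add: pos_le_divide_eq mult.commute)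
  then have "\<bar>rest p\<bar> \<le> sqrt (4 * alpha5 * q 0 / d)" for p
    using real_le_rsqrt[of "\<bar>rest p\<bar>"] by simp
  then show ?thesis
    by blast
qed

text \<open>The coefficients invert \<open>X^6 - 1\<close> modulo \<open>X^3 - X - 1\<close>.\<close>

definition prim :: "nat \<Rightarrow> real" where
  "prim p = (3 * rest (p + 2) + rest (p + 1) - 5 * rest p) / 7"

lemma prim_diff: "prim (p + 6) - prim p = rest p"
  using rest_rec[of p] rest_rec[of "p + 1"] rest_rec[of "p + 2"] rest_rec[of "p + 3"]
    rest_rec[of "p + 4"] rest_rec[of "p + 5"]
  by (simp add: prim_def eval_nat_numeral field_simps)

lemma delta5_A5_sum_eq: "delta5 (A5_sum r n) = real n * osc r + prim (6 * n + r) - prim r"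
  unfolding delta5_A5_sum
proof (induction n)
  case (Suc n)
  have "defect (6 * n + r) = osc r + (prim (6 * n + r + 6) - prim (6 * n + r))"
    unfolding prim_diff rest_def osc_mult_6_add by simp
  then show ?case
    using Suc by (simp add: algebra_simps)
qed simp

section \<open>Linear and logarithmic drift\<close>

lemma delta5_A5_sum_bounded:
  "\<exists>B>0. \<forall>r n. \<bar>delta5 (A5_sum r n) - real n * osc r\<bar> < B"
proof -
  obtain B where B: "\<bar>rest p\<bar> \<le> B" for p
    using rest_bounded by blast
  have prim: "\<bar>prim p\<bar> \<le> 9 / 7 * B" for p
    using B[of p] B[of "p + 1"] B[of "p + 2"] by (simp add: prim_def)
  \<comment> \<open>Two values of \<open>prim\<close> enter; the added 1 makes the bound strict and
    positive.\<close>
  have "\<bar>delta5 (A5_sum r n) - real n * osc r\<bar> < 18 / 7 * B + 1" for r n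
    using prim[of "6 * n + r"] prim[of r] unfolding delta5_A5_sum_eq by linarith
  moreover have "18 / 7 * B + 1 > 0"
    using B[of 0] by simp
  ultimately show ?thesis
    by blast
qed

lemma ln_A5_sum_le:
  assumes "n \<ge> 1"
  shows "ln (real (A5_sum r n)) \<le> real r * ln 2 + real n * ln 64"
proof -
  have "real (A5_sum r n) \<le> 2 ^ r * 64 ^ n"
    using of_nat_mono[OF A5_sum_le_power[of r n], where 'a = real] by simp
  then have "ln (real (A5_sum r n)) \<le> ln (2 ^ r * 64 ^ n)"
    using A5_sum_pos[OF assms, of r] by simp
  then show ?thesis
    by (simp add: ln_mult ln_realpow)
qed

theorem theorem8p5:
  "(SUP n. ereal \<bar>delta5 n\<bar>) = \<infinity> \<and>
   (\<exists>C C2 C2' K K2 K2' :: real.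
      C > 0 \<and> C2 > 0 \<and> C2' > 0 \<and> K > 0 \<and> K2 > 0 \<and> K2' > 0 \<and>
      (\<forall>n. delta5 (u5 n) > C * real n - C2 \<and> delta5 (u5' n) < - C * real n + C2') \<and>
      (\<forall>n\<ge>1. delta5 (u5 n) > K * ln (real (u5 n)) - K2 \<and>
             delta5 (u5' n) < - K * ln (real (u5' n)) + K2'))"
proof -
  define C where "C = osc 0"
  have C: "C > 0"
    using alpha5_gt by (simp add: C_def osc_0)
  obtain B where B: "B > 0" "\<bar>delta5 (A5_sum r n) - real n * osc r\<bar> < B" for r n
    using delta5_A5_sum_bounded by blast
  have lin: "delta5 (u5 n) > C * real n - B" "delta5 (u5' n) < - C * real n + B" for n
    using B(2)[of 0 n] B(2)[of 3 n] by (simp_all add: u5_eq u5'_eq osc_3 C_def abs_less_iff mult.commute)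
  \<comment> \<open>The sums are at most \<open>2 ^ r * 64 ^ n\<close>, so \<open>n\<close>
    dominates their logarithm divided by \<open>ln 64\<close>, up to a constant.\<close>
  define K where "K = C / ln 64"
  have K: "K > 0" "K * ln 64 = C"
    using C by (simp_all add: K_def)
  have log: "K * ln (real (A5_sum r n)) \<le> K * (real r * ln 2) + C * real n" if "n \<ge> 1" for r n
  proof -
    have "K * ln (real (A5_sum r n)) \<le> K * (real r * ln 2 + real n * ln 64)"
      using ln_A5_sum_le[OF that] K(1) by (intro mult_left_mono) simp_all
    also have "\<dots> = K * (real r * ln 2) + (K * ln 64) * real n"
      by (simp add: algebra_simps)
    finally show ?thesis
      unfolding K(2) .
  qed
  \<comment> \<open>The extra term absorbs the factor \<open>2 ^ r\<close> at \<open>r = 3\<close>;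
    for \<open>r = 0\<close> the constant \<open>B\<close> is enough.\<close>
  define K' where "K' = B + K * (3 * ln 2)"
  have K': "K' > 0"
    using B(1) K(1) by (simp add: K'_def add_pos_pos)
  have "delta5 (u5 n) > K * ln (real (u5 n)) - B" if "n \<ge> 1" for n
    using lin(1)[of n] log[OF that, of 0] by (simp add: u5_eq)
  moreover have "delta5 (u5' n) < - K * ln (real (u5' n)) + K'" if "n \<ge> 1" for n
    using lin(2)[of n] log[OF that, of 3] by (simp add: u5'_eq K'_def)
  moreover have "(SUP n. ereal \<bar>delta5 n\<bar>) = \<infinity>"
  proof (rule SUP_PInfty)
    fix k :: nat
    obtain n :: nat where "real n > (real k + B) / C"
      using reals_Archimedean2 by blast
    then have "C * real n - B > real k"
      using C by (simp add: field_simps)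
    then have "ereal (real k) \<le> ereal \<bar>delta5 (u5 n)\<bar>"
      using lin(1)[of n] by simp
    then show "\<exists>i\<in>UNIV. ereal (real k) \<le> ereal \<bar>delta5 i\<bar>"
      by blast
  qed
  ultimately show ?thesis
    using C B(1) K(1) K' lin by blast
qed

end
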